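(* Let $R$ be an integral domain containing a prime field of characteristic $p\ge 0$, let $n\ge1$, and let $B=R[x_1,\ldots,x_n]$ be the polynomial ring in $n$ variables over $R$. Let $f_1,\ldots,f_{n-1}\in B\setminus R[x_1^p,\ldots,x_n^p]$ and put $F=(f_1,\ldots,f_{n-1})$ and $R[F]=R[f_1,\ldots,f_{n-1}]$. Suppose that $R[F]\cong_R R^{[n-1]}$. If the natural inclusion $R[F]\to B$ is smooth, then there exists a higher $R$-derivation $D$ on $B$ of Jacobian type determined by $F$.
   Context: Notation: $R^{[m]}$ is the polynomial ring in $m$ variables over $R$; $\partial_{x_j}$ is the partial derivative with respect to $x_j$. Smoothness. A commutative $A$-algebra $B$ (via $\varphi:A\to B$) is called smooth over $A$ (and $\varphi$ is called smooth) if for every commutative $A$-algebra $C$, every ideal $N\subset C$ with $N^2=0$, and every $A$-algebra homomorphism $u:B\to C/N$, there exists an $A$-algebra homomorphism $v:B\to C$ with $\pi\circ v=u$, where $\pi:C\to C/N$ is the natural map. Higher derivations. A higher $R$-derivation on $B$ is a family $D=\{D_\ell\}_{\ell\ge0}$ of $R$-linear maps $D_\ell:B\to B$ with $D_0=\mathrm{id}_B$ and $D_\ell(fg)=\sum_{i+j=\ell}D_i(f)D_j(g)$ for all $f,g\in B$, $\ell\ge 0$. Put $B^D=\bigcap_{\ell\ge1}\ker D_\ell$. Bracket notation (computing as if in characteristic zero). For an $R$-linear map $d$ on $B$ and $b\in B$, $[d](b)$ denotes the result of the calculation of $d(b)$ as if the characteristic of $R$ were zero, i.e. $p$ is regarded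 as nonzero in $B$ during the calculation; $[d]^\ell(b)=[d]([d]^{\ell-1}(b))$. Likewise, for a matrix $A$, $[\det](A)$ is the result of calculating $\det A$ as if the characteristic were zero. Jacobian derivations. For $g\in B$, setting $f_n:=g$, put $\Delta_F(g)=\det(\partial_{x_j}(f_i))_{1\le i,j\le n}$ and $\widetilde{\Delta}_F(g)=[\det]\big([\partial_{x_j}](f_i)\big)_{1\le i,j\le n}$; that is, $\widetilde\Delta_F$ is the Jacobian derivation determined by $F$, computed as if in characteristic zero. Jacobian type. A higher $R$-derivation $D=\{D_\ell\}_{\ell\ge0}$ on $B$ is of Jacobian type determined by $F=(f_1,\ldots,f_{n-1})\in B^{n-1}$ if: (a) $R[F]\cong_R R^{[n-1]}$; (b) $f_1,\ldots,f_{n-1}\in B^D$; (c) $D_1=\widetilde\Delta_F$; (d) $D_\ell=\frac1{\ell!}[D_1]^\ell$ for all $\ell\ge0$ if $p=0$, and for $0\le\ell\le p-1$ if $p>0$. (In (c) and (d) the resulting values are elements of $B$; for $p>0$ and $\ell\le p-1$ the integer $\ell!$ is invertible in $R$.) *)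

theory Defs
  imports
    "HOL-Library.Poly_Mapping"
    "HOL-Algebra.Algebra"
    "Jordan_Normal_Form.Determinant"
begin

text \<open>
  Polynomials over \<open>'a\<close> in countably many variables \<open>x\<^sub>1, x\<^sub>2, \<dots>\<close>: finitely supported functions from
  monomials (exponent vectors) to coefficients. The variable \<open>x\<^sub>j\<^sub>+\<^sub>1\<close> has index \<open>j\<close>, and
  \<open>R[x\<^sub>1, \<dots>, x\<^sub>n]\<close> consists of the polynomials in which only variables of index below \<open>n\<close> occur.
\<close>

type_synonym 'a mpoly = "(nat \<Rightarrow>\<^sub>0 nat) \<Rightarrow>\<^sub>0 'a"

definition pconst :: "'a::zero \<Rightarrow> 'a mpoly" where
  "pconst c = Poly_Mapping.single 0 c"

definition pvar :: "nat \<Rightarrow> 'a::comm_ring_1 mpoly" where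
  "pvar j = Poly_Mapping.single (Poly_Mapping.single j 1) 1"

definition mpoly_ring :: "nat \<Rightarrow> 'a::comm_ring_1 mpoly set" where
  "mpoly_ring n = {f. \<forall>m \<in> Poly_Mapping.keys f. Poly_Mapping.keys m \<subseteq> {..<n}}"

text \<open>The ring record on a subset of a ring type, giving access to the notions of \<open>HOL-Algebra\<close>.\<close>

definition ring_on :: "'a::comm_ring_1 set \<Rightarrow> 'a ring" where
  "ring_on S = \<lparr>carrier = S, monoid.mult = (*), one = 1, ring.zero = 0, add = (+)\<rparr>"

text \<open>\<open>R[S]\<close>: the \<open>R\<close>-subalgebra generated by \<open>S\<close>, for \<open>R = 'a\<close>.\<close>

definition gen_alg :: "'a::comm_ring_1 mpoly set \<Rightarrow> 'a mpoly set" where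
  "gen_alg S = generate_ring (ring_on UNIV) (range pconst \<union> S)"

text \<open>Isomorphism of \<open>R\<close>-subalgebras of the polynomial ring.\<close>

definition alg_iso :: "'a::comm_ring_1 mpoly set \<Rightarrow> 'a mpoly set \<Rightarrow> bool" where
  "alg_iso S T \<longleftrightarrow> (\<exists>h \<in> ring_iso (ring_on S) (ring_on T). \<forall>c. h (pconst c) = pconst c)"

text \<open>
  A prime field is a field without proper subfields. Since a subfield of \<open>R\<close> has the same unit element
  as \<open>R\<close>, its characteristic is that of \<open>R\<close>.
\<close>

definition contains_prime_field :: "'a::comm_ring_1 itself \<Rightarrow> nat \<Rightarrow> bool" where
  "contains_prime_field _ p \<longleftrightarrow> CHAR('a) = p \<and>
     (\<exists>K :: 'a set. subfield K (ring_on UNIV) \<and>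
        (\<forall>K'. subfield K' (ring_on UNIV) \<and> K' \<subseteq> K \<longrightarrow> K' = K))"

text \<open>
  Smoothness of \<open>\<phi> : A \<rightarrow> B\<close>. An \<open>A\<close>-algebra \<open>C\<close> is a commutative ring with a structure map \<open>\<psi> : A \<rightarrow> C\<close>.
  HOL cannot quantify over all carrier types, so \<open>C\<close> ranges over the rings carried by subsets of
  \<open>nat \<Rightarrow> 'a + 'b\<close>. This loses nothing: with \<open>P = A[Y\<^sub>b | b \<in> B]\<close> and \<open>J\<close> the kernel of \<open>P \<rightarrow> B\<close>, every lifting
  problem \<open>(C, N, u)\<close> is the image of the one given by \<open>P / J\<^sup>2\<close>, \<open>J / J\<^sup>2\<close> and \<open>B = P / J\<close> (choose preimages in
  \<open>C\<close> of the \<open>u b\<close>), and the cardinality of \<open>P / J\<^sup>2\<close> is at most the maximum of those of \<open>A\<close>, \<open>B\<close> and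
  \<open>nat\<close>, hence at most that of \<open>nat \<Rightarrow> 'a + 'b\<close>.
\<close>

definition smooth :: "'a ring \<Rightarrow> 'b ring \<Rightarrow> ('a \<Rightarrow> 'b) \<Rightarrow> bool" where
  "smooth A B \<phi> \<longleftrightarrow> cring A \<and> cring B \<and> \<phi> \<in> Ring.ring_hom A B \<and>
     (\<forall>(C :: (nat \<Rightarrow> 'a + 'b) ring) \<psi> N u.
        cring C \<and> \<psi> \<in> Ring.ring_hom A C \<and>
        ideal N C \<and> ideal_prod C N N = {\<zero>\<^bsub>C\<^esub>} \<and>
        u \<in> Ring.ring_hom B (C Quot N) \<and> (\<forall>a \<in> carrier A. u (\<phi> a) = N +>\<^bsub>C\<^esub> \<psi> a) \<longrightarrow>
        (\<exists>v \<in> Ring.ring_hom B C. (\<forall>a \<in> carrier A. v (\<phi> a) = \<psi> a) \<and>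
           (\<forall>b \<in> carrier B. N +>\<^bsub>C\<^esub> v b = u b)))"

text \<open>Higher \<open>R\<close>-derivations on \<open>B = R[x\<^sub>1, \<dots>, x\<^sub>n]\<close>; the values of the \<open>D \<ell>\<close> outside \<open>B\<close> are irrelevant.\<close>

definition higher_derivation :: "nat \<Rightarrow> (nat \<Rightarrow> 'a::comm_ring_1 mpoly \<Rightarrow> 'a mpoly) \<Rightarrow> bool" where
  "higher_derivation n D \<longleftrightarrow>
     (\<forall>l. \<forall>f \<in> mpoly_ring n. D l f \<in> mpoly_ring n) \<and>
     (\<forall>l. \<forall>f \<in> mpoly_ring n. \<forall>g \<in> mpoly_ring n. D l (f + g) = D l f + D l g) \<and>
     (\<forall>l c. \<forall>f \<in> mpoly_ring n. D l (pconst c * f) = pconst c * D l f) \<and>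
     (\<forall>f \<in> mpoly_ring n. D 0 f = f) \<and>
     (\<forall>l. \<forall>f \<in> mpoly_ring n. \<forall>g \<in> mpoly_ring n. D l (f * g) = (\<Sum>i\<le>l. D i f * D (l - i) g))"

definition hd_kernel :: "nat \<Rightarrow> (nat \<Rightarrow> 'a::comm_ring_1 mpoly \<Rightarrow> 'a mpoly) \<Rightarrow> 'a mpoly set" where
  "hd_kernel n D = {b \<in> mpoly_ring n. \<forall>l\<ge>1. D l b = 0}"

definition pderiv_wrt :: "nat \<Rightarrow> 'a::comm_ring_1 mpoly \<Rightarrow> 'a mpoly" where
  "pderiv_wrt j f = (\<Sum>m \<in> Poly_Mapping.keys f.
     Poly_Mapping.single (m - Poly_Mapping.single j 1)
       (of_nat (Poly_Mapping.lookup m j) * Poly_Mapping.lookup f m))"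

text \<open>\<open>\<Delta>\<^sub>F(g)\<close> for \<open>F = [f\<^sub>1, \<dots>, f\<^sub>n\<^sub>-\<^sub>1]\<close>, with \<open>f\<^sub>n = g\<close>.\<close>

definition jacobian_der :: "nat \<Rightarrow> 'a::comm_ring_1 mpoly list \<Rightarrow> 'a mpoly \<Rightarrow> 'a mpoly" where
  "jacobian_der n F g = det (mat n n (\<lambda>(i, j). pderiv_wrt j ((F @ [g]) ! i)))"

text \<open>
  Calculations ``as if the characteristic were zero'': every coefficient \<open>c \<in> R\<close> is replaced by an
  indeterminate \<open>T\<^sub>c\<close>, the calculation is carried out over the characteristic zero domain
  \<open>\<int>[T\<^sub>c | c \<in> R]\<close>, in which \<open>p\<close> is nonzero, and only the final result is read in \<open>R\<close> through
  \<open>T\<^sub>c \<mapsto> c\<close>. The values obtained are those of any other characteristic zero ring mapping onto \<open>R\<close>.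
  (\<open>Poly_Mapping.map\<close> leaves zero coefficients zero.)
\<close>

type_synonym 'a char0 = "('a \<Rightarrow>\<^sub>0 nat) \<Rightarrow>\<^sub>0 int"

definition char0_lift :: "'a::comm_ring_1 mpoly \<Rightarrow> 'a char0 mpoly" where
  "char0_lift f = Poly_Mapping.map (\<lambda>c. Poly_Mapping.single (Poly_Mapping.single c 1) 1) f"

definition char0_eval :: "'a::comm_ring_1 char0 \<Rightarrow> 'a" where
  "char0_eval q = (\<Sum>m \<in> Poly_Mapping.keys q.
     of_int (Poly_Mapping.lookup q m) * (\<Prod>c \<in> Poly_Mapping.keys m. c ^ Poly_Mapping.lookup m c))"

definition char0_reduce :: "'a::comm_ring_1 char0 mpoly \<Rightarrow> 'a mpoly" where
  "char0_reduce = Poly_Mapping.map char0_eval"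

text \<open>\<open>[\<Delta>\<^sub>F]\<^sup>\<ell>(g)\<close>; for \<open>\<ell> = 1\<close> this is the Jacobian derivation \<open>[det]([\<partial>](f\<^sub>i))\<close> with \<open>f\<^sub>n = g\<close>.\<close>

definition bracket_jacobian_pow ::
  "nat \<Rightarrow> 'a::comm_ring_1 mpoly list \<Rightarrow> nat \<Rightarrow> 'a mpoly \<Rightarrow> 'a mpoly" where
  "bracket_jacobian_pow n F l g =
     char0_reduce ((jacobian_der n (map char0_lift F) ^^ l) (char0_lift g))"

definition tilde_jacobian_der ::
  "nat \<Rightarrow> 'a::comm_ring_1 mpoly list \<Rightarrow> 'a mpoly \<Rightarrow> 'a mpoly" where
  "tilde_jacobian_der n F = bracket_jacobian_pow n F 1"

text \<open>
  In the last clause \<open>\<ell>!\<close> is a unit of \<open>R\<close> whenever \<open>R\<close> contains a field of characteristic \<open>p\<close>.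
\<close>

definition jacobian_type ::
  "nat \<Rightarrow> nat \<Rightarrow> 'a::comm_ring_1 mpoly list \<Rightarrow> (nat \<Rightarrow> 'a mpoly \<Rightarrow> 'a mpoly) \<Rightarrow> bool" where
  "jacobian_type p n F D \<longleftrightarrow>
     alg_iso (gen_alg (set F)) (mpoly_ring (n - 1)) \<and>
     set F \<subseteq> hd_kernel n D \<and>
     (\<forall>g \<in> mpoly_ring n. D 1 g = tilde_jacobian_der n F g) \<and>
     (\<forall>l. p = 0 \<or> l \<le> p - 1 \<longrightarrow>
        (\<forall>g \<in> mpoly_ring n. D l g =
           pconst (inv\<^bsub>ring_on (UNIV :: 'a set)\<^esub> of_nat (fact l)) * bracket_jacobian_pow n F l g))"

end

theory Submission
  imports Defs "HOL-Computational_Algebra.Formal_Power_Series"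
begin

text \<open>
  Reading the characteristic zero calculation in \<open>R\<close> is a ring homomorphism that commutes with partial
  derivatives, so \<open>[\<Delta>\<^sub>F]\<^sup>l\<close> is the iterate of the derivation \<open>\<Delta>\<^sub>F\<close>, which vanishes on \<open>R[F]\<close>. The components
  \<open>\<Delta>\<^sub>F\<^sup>l / l!\<close> (\<open>l < p\<close>, or all \<open>l\<close> if \<open>p = 0\<close>) satisfy the Leibniz rules. For \<open>p > 0\<close> they form an
  \<open>R[F]\<close>-algebra map \<open>B \<rightarrow> B[t]/(t\<^sup>p)\<close>, which smoothness lifts successively to \<open>B[t]/(t\<^sup>m\<^sup>+\<^sup>1)\<close> for all \<open>m \<ge> p\<close>.
\<close>

section \<open>Subrings and truncated power series\<close>

lemma ring_on_simps [simp]: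
  "carrier (ring_on S) = S" "monoid.mult (ring_on S) = (*)" "monoid.one (ring_on S) = 1"
  "ring.zero (ring_on S) = 0" "ring.add (ring_on S) = (+)"
  by (simp_all add: ring_on_def)

lemma cring_ring_onD:
  assumes "cring (ring_on S)"
  shows "0 \<in> S" "1 \<in> S" "\<And>a b. a \<in> S \<Longrightarrow> b \<in> S \<Longrightarrow> a + b \<in> S"
    "\<And>a b. a \<in> S \<Longrightarrow> b \<in> S \<Longrightarrow> a * b \<in> S" "\<And>a. a \<in> S \<Longrightarrow> - a \<in> S"
proof -
  interpret cring "ring_on S" by fact
  show "0 \<in> S" "1 \<in> S" using zero_closed one_closed by simp_all
  show "\<And>a b. a \<in> S \<Longrightarrow> b \<in> S \<Longrightarrow> a + b \<in> S" using a_closed by simp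
  show "\<And>a b. a \<in> S \<Longrightarrow> b \<in> S \<Longrightarrow> a * b \<in> S" using m_closed by simp
  fix a assume a: "a \<in> S"
  then have "a + (\<ominus>\<^bsub>ring_on S\<^esub> a) = 0" "(\<ominus>\<^bsub>ring_on S\<^esub> a) \<in> S"
    using r_neg[of a] a_inv_closed[of a] by simp_all
  then show "- a \<in> S" by (simp add: add_eq_0_iff)
qed

lemma cring_ring_on_sum:
  assumes "cring (ring_on S)" "\<And>i. i \<in> I \<Longrightarrow> f i \<in> S"
  shows "sum f I \<in> S"
  using assms(2) by (induction I rule: infinite_finite_induct) (auto simp: cring_ring_onD[OF assms(1)])

text \<open>The ring \<open>B[t]/(t\<^sup>m\<^sup>+\<^sup>1)\<close>, on the carrier type over which \<^const>\<open>smooth\<close> quantifies.\<close>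

definition trunc :: "nat \<Rightarrow> 'b::zero fps \<Rightarrow> nat \<Rightarrow> 'a + 'b" where
  "trunc m f = (\<lambda>k. Inr (if k \<le> m then fps_nth f k else 0))"

definition untrunc :: "(nat \<Rightarrow> 'a + 'b) \<Rightarrow> 'b fps" where
  "untrunc a = Abs_fps (\<lambda>k. projr (a k))"

definition fps_over :: "'b::zero set \<Rightarrow> 'b fps set" where
  "fps_over B = {f. \<forall>k. fps_nth f k \<in> B}"

text \<open>Power series modulo t^(m+1) also give B[t]/(t^(m+1)), so the operations are borrowed
  from \<open>'b fps\<close>.\<close>

definition trunc_ring :: "'b::comm_ring_1 set \<Rightarrow> nat \<Rightarrow> (nat \<Rightarrow> 'a + 'b) ring" where
  "trunc_ring B m = \<lparr>carrier = trunc m ` fps_over B,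
     monoid.mult = (\<lambda>a b. trunc m (untrunc a * untrunc b)), one = trunc m 1,
     ring.zero = trunc m 0, add = (\<lambda>a b. trunc m (untrunc a + untrunc b))\<rparr>"

lemma nth_untrunc_trunc: "fps_nth (untrunc (trunc m f)) k = (if k \<le> m then fps_nth f k else 0)"
  by (simp add: untrunc_def trunc_def)

lemma trunc_eq_iff: "trunc m f = trunc m g \<longleftrightarrow> (\<forall>k\<le>m. fps_nth f k = fps_nth g k)"
  by (auto simp: trunc_def fun_eq_iff)

text \<open>Coefficients up to \<open>m\<close> of a product depend only on the coefficients up to
  \<open>m\<close> of the factors, so \<open>trunc m\<close> is a homomorphism and the ring laws
  descend from power series.\<close>

lemma trunc_ring_simps [simp]:
  "monoid.mult (trunc_ring B m) (trunc m f) (trunc m g) = trunc m (f * g)"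
  "ring.add (trunc_ring B m) (trunc m f) (trunc m g) = trunc m (f + g)"
  "monoid.one (trunc_ring B m) = trunc m 1" "ring.zero (trunc_ring B m) = trunc m 0"
  "carrier (trunc_ring B m) = trunc m ` fps_over B"
  by (auto simp: trunc_ring_def trunc_eq_iff nth_untrunc_trunc fps_mult_nth intro!: sum.cong)

lemma fps_over_closed:
  assumes "cring (ring_on B)"
  shows "0 \<in> fps_over B" "1 \<in> fps_over B"
    "\<And>f g. f \<in> fps_over B \<Longrightarrow> g \<in> fps_over B \<Longrightarrow> f * g \<in> fps_over B"
    "\<And>f g. f \<in> fps_over B \<Longrightarrow> g \<in> fps_over B \<Longrightarrow> f + g \<in> fps_over B"
    "\<And>f. f \<in> fps_over B \<Longrightarrow> - f \<in> fps_over B"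
  by (auto simp: fps_over_def fps_mult_nth cring_ring_onD[OF assms] intro!: cring_ring_on_sum[OF assms])

lemma cring_trunc_ring:
  assumes B: "cring (ring_on B)"
  shows "cring (trunc_ring B m :: (nat \<Rightarrow> 'a + 'b::comm_ring_1) ring)"
proof -
  let ?C = "trunc_ring B m :: (nat \<Rightarrow> 'a + 'b) ring"
  note cl = fps_over_closed[OF B]
  have inv: "\<exists>y\<in>carrier ?C. y \<oplus>\<^bsub>?C\<^esub> x = \<zero>\<^bsub>?C\<^esub>" if "x \<in> carrier ?C" for x
  proof -
    obtain f where f: "x = trunc m f" "f \<in> fps_over B" using \<open>x \<in> _\<close> by auto
    then show ?thesis
      by (intro bexI[of _ "trunc m (- f)"]) (auto simp: cl)
  qed
  show ?thesis
    by (intro cringI abelian_groupI comm_monoidI inv)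
      (auto simp: cl algebra_simps)
qed

lemma minus_trunc_ring:
  assumes B: "cring (ring_on B)" and f: "f \<in> fps_over B"
  shows "\<ominus>\<^bsub>trunc_ring B m\<^esub> trunc m f = (trunc m (- f) :: nat \<Rightarrow> 'a + 'b::comm_ring_1)"
proof -
  interpret cring "trunc_ring B m :: (nat \<Rightarrow> 'a + 'b) ring" by (rule cring_trunc_ring[OF B])
  show ?thesis
    using f by (intro minus_equality) (auto simp: fps_over_closed[OF B])
qed

text \<open>The ideal t^m B[t]/(t^(m+1)), the kernel of the projection to B[t]/(t^m).\<close>

definition trunc_top :: "'b::zero set \<Rightarrow> nat \<Rightarrow> (nat \<Rightarrow> 'a + 'b) set" where
  "trunc_top B m = trunc m ` {f \<in> fps_over B. \<forall>k<m. fps_nth f k = 0}"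

lemma trunc_top_iff:
  assumes "f \<in> fps_over B"
  shows "trunc m f \<in> trunc_top B m \<longleftrightarrow> (\<forall>k<m. fps_nth f k = 0)"
  using assms by (auto simp: trunc_top_def trunc_eq_iff)

lemma ideal_trunc_top:
  assumes B: "cring (ring_on B)"
  shows "ideal (trunc_top B m) (trunc_ring B m :: (nat \<Rightarrow> 'a + 'b::comm_ring_1) ring)"
    (is "ideal ?N ?C")
proof -
  note cl = fps_over_closed[OF B]
  interpret C: cring ?C by (rule cring_trunc_ring[OF B])
  have sub: "?N \<subseteq> carrier ?C" by (auto simp: trunc_top_def)
  have mult: "a \<otimes>\<^bsub>?C\<^esub> x \<in> ?N" if a: "a \<in> ?N" and x: "x \<in> carrier ?C" for a x
  proof -
    obtain f where f: "a = trunc m f" "f \<in> fps_over B" "\<forall>k<m. fps_nth f k = 0"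
      using a by (auto simp: trunc_top_def)
    obtain g where g: "x = trunc m g" "g \<in> fps_over B"
      using x by auto
    have "fps_nth (f * g) k = 0" if "k < m" for k
      using f(3) that by (auto simp: fps_mult_nth intro!: sum.neutral)
    then show ?thesis using f g by (auto simp: cl trunc_top_iff)
  qed
  show ?thesis
  proof (rule idealI[OF C.ring_axioms])
    show "subgroup ?N (add_monoid ?C)"
    proof (rule C.add.subgroupI)
      show "?N \<subseteq> carrier ?C" by (rule sub)
      show "?N \<noteq> {}" using trunc_top_iff[OF cl(1), of m] by auto
    next
      fix a assume "a \<in> ?N"
      then show "\<ominus>\<^bsub>?C\<^esub> a \<in> ?N"
        by (auto simp: trunc_top_def cl minus_trunc_ring[OF B])
    next
      fix a b assume "a \<in> ?N" "b \<in> ?N"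
      then show "a \<oplus>\<^bsub>?C\<^esub> b \<in> ?N" by (auto simp: trunc_top_def cl)
    qed
  next
    fix a x assume a: "a \<in> ?N" "x \<in> carrier ?C"
    then show "a \<otimes>\<^bsub>?C\<^esub> x \<in> ?N" by (rule mult)
    then show "x \<otimes>\<^bsub>?C\<^esub> a \<in> ?N" using C.m_comm[of x a] a sub by auto
  qed
qed

text \<open>A product of two series of order at least m has order at least 2m > m, so it vanishes
  modulo t^(m+1).\<close>

lemma trunc_top_square:
  assumes B: "cring (ring_on B)" and m: "m \<ge> 1"
  shows "ideal_prod (trunc_ring B m) (trunc_top B m) (trunc_top B m) =
    {trunc m 0 :: nat \<Rightarrow> 'a + 'b::comm_ring_1}"
    (is "ideal_prod ?C ?N _ = _")
proof -
  have prod0: "i \<otimes>\<^bsub>?C\<^esub> j = trunc m 0" if i: "i \<in> ?N" and j: "j \<in> ?N" for i j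
  proof -
    obtain f where f: "i = trunc m f" "\<forall>k<m. fps_nth f k = 0"
      using i by (auto simp: trunc_top_def)
    obtain g where g: "j = trunc m g" "\<forall>k<m. fps_nth g k = 0"
      using j by (auto simp: trunc_top_def)
    have "fps_nth (f * g) k = 0" if "k \<le> m" for k
      unfolding fps_mult_nth
    proof (rule sum.neutral, rule ballI)
      fix i assume "i \<in> {0..k}"
      then have "i < m \<or> k - i < m" using that m by auto
      then show "fps_nth f i * fps_nth g (k - i) = 0" using f g by auto
    qed
    then show ?thesis using f g by (auto simp: trunc_eq_iff)
  qed
  have "x = trunc m 0" if "x \<in> ideal_prod ?C ?N ?N" for x
    using that by (induction rule: ideal_prod.induct) (auto simp: prod0)
  moreover have "trunc m 0 \<in> ?N"
    using trunc_top_iff[OF fps_over_closed(1)[OF B]] by simp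
  then have "trunc m 0 \<in> ideal_prod ?C ?N ?N"
    using ideal_prod.prod[of "trunc m 0" ?N "trunc m 0" ?N ?C] prod0 by simp
  ultimately show ?thesis by blast
qed

text \<open>This identifies the quotient with B[t]/(t^m): the difference of two representatives lies
  in the ideal exactly when its coefficients below \<open>m\<close> vanish.\<close>

lemma trunc_top_coset_eq_iff:
  assumes B: "cring (ring_on B)" and f: "f \<in> fps_over B" and g: "g \<in> fps_over B"
  shows "trunc_top B m +>\<^bsub>trunc_ring B m\<^esub> (trunc m f :: nat \<Rightarrow> 'a + 'b::comm_ring_1) =
      trunc_top B m +>\<^bsub>trunc_ring B m\<^esub> trunc m g \<longleftrightarrow> (\<forall>k<m. fps_nth f k = fps_nth g k)"
    (is "?N +>\<^bsub>?C\<^esub> _ = _ \<longleftrightarrow> _")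
proof -
  interpret C: cring ?C by (rule cring_trunc_ring[OF B])
  note cl = fps_over_closed[OF B]
  have "trunc m f \<ominus>\<^bsub>?C\<^esub> trunc m g = trunc m (f - g)"
    by (simp add: C.minus_eq minus_trunc_ring[OF B g])
  moreover have "f - g \<in> fps_over B" using cl(4)[OF f cl(5)[OF g]] by simp
  ultimately show ?thesis
    using C.quotient_eq_iff_same_a_r_cos[OF ideal_trunc_top[OF B], of "trunc m f" "trunc m g"] f g
    by (simp add: trunc_top_iff)
qed

section \<open>Extending truncated higher derivations\<close>

text \<open>\<open>r\<close> can be the component of order \<open>m\<close> of a higher \<open>A\<close>-derivation on \<open>B\<close> that starts with
  \<open>D 0, \<dots>, D (m - 1)\<close>.\<close>

definition hd_component :: "'b::comm_ring_1 set \<Rightarrow> 'b set \<Rightarrow> (nat \<Rightarrow> 'b \<Rightarrow> 'b) \<Rightarrow> nat \<Rightarrow> ('b \<Rightarrow> 'b) \<Rightarrow> bool" where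
  "hd_component A B D m r \<longleftrightarrow>
     (\<forall>f\<in>B. r f \<in> B) \<and>
     (\<forall>f\<in>B. \<forall>g\<in>B. r (f + g) = r f + r g) \<and>
     (m = 0 \<longrightarrow> (\<forall>f\<in>B. r f = f)) \<and>
     (m \<ge> 1 \<longrightarrow> (\<forall>a\<in>A. r a = 0)) \<and>
     (\<forall>f\<in>B. \<forall>g\<in>B. r (f * g) = (\<Sum>i\<le>m. (D(m := r)) i f * (D(m := r)) (m - i) g))"

text \<open>The components below \<open>m\<close> are an \<open>A\<close>-algebra map \<open>B \<rightarrow> B[t]/(t\<^sup>m)\<close>; it lifts along the square zero
  extension \<open>B[t]/(t\<^sup>m\<^sup>+\<^sup>1) \<rightarrow> B[t]/(t\<^sup>m)\<close>.\<close>

lemma smooth_extend_higher_derivation: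
  fixes A B :: "'b::comm_ring_1 set"
  assumes sm: "smooth (ring_on A) (ring_on B) (\<lambda>b. b)" and m: "m \<ge> 1"
    and D: "\<And>i. i < m \<Longrightarrow> hd_component A B D i (D i)"
  shows "\<exists>r. hd_component A B D m r"
proof -
  have crA: "cring (ring_on A)" and crB: "cring (ring_on B)"
    and AB: "A \<subseteq> B"
    using sm by (auto simp: smooth_def Ring.ring_hom_def)
  note clA = cring_ring_onD[OF crA] and clB = cring_ring_onD[OF crB] and cl = fps_over_closed[OF crB]
  define C :: "(nat \<Rightarrow> 'b + 'b) ring" where "C = trunc_ring B m"
  define N :: "(nat \<Rightarrow> 'b + 'b) set" where "N = trunc_top B m"
  \<comment> \<open>Representatives of the truncated map sending f to the sum of the
    \<open>D k f\<close> t^k with \<open>k < m\<close>. The coefficient of t^m is lost modulo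
    \<open>N\<close>, so 0 serves as a default.\<close>
  define w :: "'b \<Rightarrow> 'b fps" where "w f = Abs_fps (\<lambda>k. if k < m then D k f else 0)" for f
  have DB: "D i f \<in> B" if "i < m" "f \<in> B" for i f
    using D[OF \<open>i < m\<close>] that by (simp add: hd_component_def)
  have Dadd: "D i (f + g) = D i f + D i g" if "i < m" "f \<in> B" "g \<in> B" for i f g
    using D[OF \<open>i < m\<close>] that by (simp add: hd_component_def)
  have Dmult: "D k (f * g) = (\<Sum>i\<le>k. D i f * D (k - i) g)" if "k < m" "f \<in> B" "g \<in> B" for k f g
    using D[OF \<open>k < m\<close>] that by (simp add: hd_component_def)
  have D0: "D 0 f = f" if "f \<in> B" for f
    using D[of 0] m that by (simp add: hd_component_def)
  have DA: "D i a = 0" if "i < m" "i \<ge> 1" "a \<in> A" for i a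
    using D[OF \<open>i < m\<close>] that by (simp add: hd_component_def)
  have wB: "w f \<in> fps_over B" if "f \<in> B" for f
    using that by (simp add: fps_over_def w_def DB clB)
  have wC: "trunc m (w f) \<in> carrier C" if "f \<in> B" for f
    using wB[OF that] by (simp add: C_def)
  interpret C: cring C unfolding C_def by (rule cring_trunc_ring[OF crB])
  have idN: "ideal N C" unfolding N_def C_def by (rule ideal_trunc_top[OF crB])
  interpret N: ideal N C by (rule idN)
  have ops: "trunc m f \<otimes>\<^bsub>C\<^esub> trunc m g = trunc m (f * g)" "trunc m f \<oplus>\<^bsub>C\<^esub> trunc m g = trunc m (f + g)"
    "\<one>\<^bsub>C\<^esub> = trunc m 1" "\<zero>\<^bsub>C\<^esub> = trunc m 0" for f g
    by (simp_all add: C_def)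
  have coset: "N +>\<^bsub>C\<^esub> trunc m f = N +>\<^bsub>C\<^esub> trunc m g \<longleftrightarrow> (\<forall>k<m. fps_nth f k = fps_nth g k)"
    if "f \<in> fps_over B" "g \<in> fps_over B" for f g
    unfolding N_def C_def by (rule trunc_top_coset_eq_iff[OF crB that])
  define u where "u f = N +>\<^bsub>C\<^esub> trunc m (w f)" for f
  define \<psi> :: "'b \<Rightarrow> nat \<Rightarrow> 'b + 'b" where "\<psi> a = trunc m (fps_const a)" for a
  have \<psi>: "\<psi> \<in> Ring.ring_hom (ring_on A) C"
    using AB by (intro ring_hom_memI) (auto simp: \<psi>_def ops C_def fps_over_def clB)
  have u: "u \<in> Ring.ring_hom (ring_on B) (C Quot N)"
  proof (rule ring_hom_memI)
    fix f assume "f \<in> carrier (ring_on B)"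
    then show "u f \<in> carrier (C Quot N)"
      using wC[of f] by (auto simp: u_def FactRing_def A_RCOSETS_def')
  next
    fix f g assume fg: "f \<in> carrier (ring_on B)" "g \<in> carrier (ring_on B)"
    then have B: "f \<in> B" "g \<in> B" "f * g \<in> B" "f + g \<in> B" by (auto simp: clB)
    \<comment> \<open>\<open>w\<close> is multiplicative only below degree \<open>m\<close>:
      \<open>w f * w g\<close> may have a nonzero coefficient at \<open>m\<close>, which the coset
      does not see.\<close>
    have "fps_nth (w (f * g)) k = fps_nth (w f * w g) k" if "k < m" for k
      using that B by (auto simp: w_def fps_mult_nth Dmult atLeast0AtMost intro!: sum.cong)
    then have "u (f * g) = N +>\<^bsub>C\<^esub> (trunc m (w f) \<otimes>\<^bsub>C\<^esub> trunc m (w g))"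
      unfolding u_def ops by (subst coset) (use wB B cl in auto)
    then show "u (f \<otimes>\<^bsub>ring_on B\<^esub> g) = u f \<otimes>\<^bsub>C Quot N\<^esub> u g"
      using B by (simp add: u_def FactRing_def N.rcoset_mult_add wC)
    have "fps_nth (w (f + g)) k = fps_nth (w f + w g) k" if "k < m" for k
      using that B by (auto simp: w_def Dadd)
    then have "u (f + g) = N +>\<^bsub>C\<^esub> (trunc m (w f) \<oplus>\<^bsub>C\<^esub> trunc m (w g))"
      unfolding u_def ops by (subst coset) (use wB B cl in auto)
    then show "u (f \<oplus>\<^bsub>ring_on B\<^esub> g) = u f \<oplus>\<^bsub>C Quot N\<^esub> u g"
      using B by (simp add: u_def FactRing_def N.a_rcos_sum wC)
  next
    \<comment> \<open>Since \<open>1 \<in> A\<close>, the components of positive order kill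
      it.\<close>
    have "fps_nth (w 1) k = fps_nth 1 k" if "k < m" for k
      using that by (cases k) (auto simp: w_def D0 DA clA clB)
    then show "u \<one>\<^bsub>ring_on B\<^esub> = \<one>\<^bsub>C Quot N\<^esub>"
      unfolding u_def FactRing_def by (simp add: ops) (subst coset, use wB clB cl in auto)
  qed
  have u\<psi>: "u a = N +>\<^bsub>C\<^esub> \<psi> a" if "a \<in> A" for a
  proof -
    have "fps_nth (w a) k = fps_nth (fps_const a) k" if "k < m" for k
      using that \<open>a \<in> A\<close> AB by (cases k) (auto simp: w_def D0 DA)
    then show ?thesis unfolding u_def \<psi>_def
      by (subst coset) (use wB AB clB \<open>a \<in> A\<close> in \<open>auto simp: fps_over_def\<close>)
  qed
  have "ideal_prod C N N = {\<zero>\<^bsub>C\<^esub>}"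
    unfolding ops unfolding C_def N_def by (rule trunc_top_square[OF crB m])
  then obtain v where v: "v \<in> Ring.ring_hom (ring_on B) C" and vA: "\<And>a. a \<in> A \<Longrightarrow> v a = \<psi> a"
    and vu: "\<And>b. b \<in> B \<Longrightarrow> N +>\<^bsub>C\<^esub> v b = u b"
    using sm \<psi> idN u u\<psi> C.cring_axioms unfolding smooth_def
    by (metis ring_on_simps(1))
  define \<phi> where "\<phi> f = untrunc (v f)" for f
  have vC: "v f \<in> carrier C" if "f \<in> B" for f using v that by (auto simp: Ring.ring_hom_def)
  have v\<phi>: "v f = trunc m (\<phi> f)" and \<phi>B: "\<phi> f \<in> fps_over B" if f: "f \<in> B" for f
    using vC[OF f] by (auto simp: C_def fps_over_def \<phi>_def trunc_eq_iff nth_untrunc_trunc clB)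
  \<comment> \<open>Because \<open>v\<close> lifts \<open>u\<close>, its coefficients below
    \<open>m\<close> are the given components; only the coefficient of t^m, taken as
    \<open>r\<close>, is new.\<close>
  have \<phi>D: "fps_nth (\<phi> f) k = D k f" if "f \<in> B" "k < m" for f k
    using vu[OF \<open>f \<in> B\<close>] that unfolding u_def v\<phi>[OF \<open>f \<in> B\<close>]
    by (subst (asm) coset) (use \<phi>B wB in \<open>auto simp: w_def\<close>)
  define r where "r f = fps_nth (\<phi> f) m" for f
  have "hd_component A B D m r"
    unfolding hd_component_def
  proof (intro conjI ballI impI)
    fix f assume "f \<in> B" then show "r f \<in> B" using \<phi>B by (auto simp: r_def fps_over_def)
  next
    fix f assume "m = 0" then show "r f = f" using m by simp
  next
    fix a assume a: "a \<in> A"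
    then have "trunc m (\<phi> a) = (trunc m (fps_const a) :: nat \<Rightarrow> 'b + 'b)"
      using v\<phi>[of a] vA[of a] AB by (auto simp: \<psi>_def)
    then show "r a = 0" using m by (auto simp: trunc_eq_iff r_def)
  next
    fix f g assume fg: "f \<in> B" "g \<in> B"
    then have B: "f * g \<in> B" "f + g \<in> B" by (auto simp: clB)
    have "v (f + g) = v f \<oplus>\<^bsub>C\<^esub> v g" "v (f * g) = v f \<otimes>\<^bsub>C\<^esub> v g"
      using v fg by (auto simp: Ring.ring_hom_def)
    then have *: "trunc m (\<phi> (f + g)) = (trunc m (\<phi> f + \<phi> g) :: nat \<Rightarrow> 'b + 'b)"
       "trunc m (\<phi> (f * g)) = (trunc m (\<phi> f * \<phi> g) :: nat \<Rightarrow> 'b + 'b)"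
      using fg B by (simp_all add: v\<phi> ops)
    then show "r (f + g) = r f + r g" by (auto simp: trunc_eq_iff r_def)
    \<comment> \<open>With the components read as coefficients, the rule for \<open>r\<close> is the
      coefficient of t^m in the Cauchy product.\<close>
    have "(D(m := r)) i h = fps_nth (\<phi> h) i" if "i \<le> m" "h \<in> B" for i h
      using that by (auto simp: r_def \<phi>D)
    then show "r (f * g) = (\<Sum>i\<le>m. (D(m := r)) i f * (D(m := r)) (m - i) g)"
      using * fg by (auto simp: trunc_eq_iff r_def fps_mult_nth atLeast0AtMost)
  qed
  then show ?thesis by blast
qed


text \<open>\<open>D\<close> is overwritten at \<open>m\<close> and read only below it, so the
  condition depends on earlier choices alone, as recursive choice requires.\<close>

lemma hd_component_cong:
  assumes "\<And>y. y < m \<Longrightarrow> D y = D' y"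
  shows "hd_component A B D m r = hd_component A B D' m r"
proof -
  have "(D(m := r)) i = (D'(m := r)) i" if "i \<le> m" for i
    using assms that by auto
  then show ?thesis by (simp add: hd_component_def)
qed

section \<open>Polynomials\<close>

text \<open>A finitely supported function is a finite sum of monomials, so a property stable under
  sums need only be tested on these.\<close>

lemma poly_mapping_single_induct:
  assumes single: "\<And>k v. P (Poly_Mapping.single k v)" and add: "\<And>f g. P f \<Longrightarrow> P g \<Longrightarrow> P (f + g)"
  shows "P (f :: 'k \<Rightarrow>\<^sub>0 'a::comm_monoid_add)"
proof (induction f rule: update_induct)
  case const
  then show ?case using single[of undefined 0] by simp
next
  case (update f a b)
  have "Poly_Mapping.update a b f = Poly_Mapping.single a b + f"
    using update(1) by (intro poly_mapping_eqI) (auto simp: lookup_update lookup_add lookup_single in_keys_iff)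
  then show ?case using single add update by simp
qed

text \<open>Both sides are additive in each factor, so agreement on products of monomials
  suffices.\<close>

lemma poly_mapping_mult_hom:
  fixes h :: "('k::monoid_add \<Rightarrow>\<^sub>0 'a::semiring_0) \<Rightarrow> 'c::semiring_0"
  assumes add: "\<And>f g. h (f + g) = h f + h g"
    and single: "\<And>k a l b. h (Poly_Mapping.single k a * Poly_Mapping.single l b) =
      h (Poly_Mapping.single k a) * h (Poly_Mapping.single l b)"
  shows "h (f * g) = h f * h g"
proof (induction f rule: poly_mapping_single_induct)
  case (1 k v)
  show ?case
    by (induction g rule: poly_mapping_single_induct) (simp_all add: single add distrib_left)
qed (simp add: add distrib_right)

lemma pconst_mult: "pconst (a * b) = pconst a * pconst b" for a b :: "'a::comm_ring_1"
  by (simp add: pconst_def mult_single)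

lemma pconst_1: "pconst 1 = (1 :: 'a::comm_ring_1 mpoly)"
  by (simp add: pconst_def)

lemma pconst_of_nat: "pconst (of_nat k) = (of_nat k :: 'a::comm_ring_1 mpoly)"
  by (simp add: pconst_def)

section \<open>Partial derivatives\<close>

lemma pderiv_wrt_add: "pderiv_wrt j (f + g) = pderiv_wrt j f + pderiv_wrt j g"
  unfolding pderiv_wrt_def
  by (rule setsum_keys_plus_distrib) (simp_all add: distrib_left single_add)

lemma pderiv_wrt_single:
  "pderiv_wrt j (Poly_Mapping.single m a) =
    Poly_Mapping.single (m - Poly_Mapping.single j 1) (of_nat (Poly_Mapping.lookup m j) * a)"
  by (cases "a = 0") (simp_all add: pderiv_wrt_def)

lemma pderiv_wrt_pconst: "pderiv_wrt j (pconst c) = 0"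
  by (simp add: pconst_def pderiv_wrt_single)

lemma pderiv_wrt_mult_single:
  fixes a b :: "'a::comm_ring_1"
  shows "pderiv_wrt j (Poly_Mapping.single m a * Poly_Mapping.single k b) =
    pderiv_wrt j (Poly_Mapping.single m a) * Poly_Mapping.single k b +
    Poly_Mapping.single m a * pderiv_wrt j (Poly_Mapping.single k b)"
proof -
  \<comment> \<open>Subtraction of exponents is truncated and may fail to commute with adding
    \<open>k\<close> when variable \<open>j\<close> does not occur in \<open>m\<close>; then the
    coefficient is 0 and both sides vanish.\<close>
  have shift: "Poly_Mapping.single (m - Poly_Mapping.single j 1 + k) (of_nat (Poly_Mapping.lookup m j) * c) =
      Poly_Mapping.single (m + k - Poly_Mapping.single j 1) (of_nat (Poly_Mapping.lookup m j) * c)"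
    for m k and c :: 'a
  proof (cases "Poly_Mapping.lookup m j = 0")
    case False
    then have "m - Poly_Mapping.single j 1 + k = m + k - Poly_Mapping.single j 1"
      by (intro poly_mapping_eqI) (auto simp: lookup_add lookup_minus lookup_single when_def)
    then show ?thesis by simp
  qed simp
  show ?thesis
    using shift[of m k "a * b"] shift[of k m "a * b"]
    by (simp add: pderiv_wrt_single mult_single lookup_add single_add algebra_simps)
qed

lemma pderiv_wrt_mult:
  fixes f g :: "'a::comm_ring_1 mpoly"
  shows "pderiv_wrt j (f * g) = pderiv_wrt j f * g + f * pderiv_wrt j g"
proof (induction f rule: poly_mapping_single_induct)
  case (1 k v)
  show ?case
    by (induction g rule: poly_mapping_single_induct)
      (simp_all add: pderiv_wrt_mult_single pderiv_wrt_add algebra_simps)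
qed (simp add: pderiv_wrt_add algebra_simps)

section \<open>The subring of polynomials in the first n variables\<close>

lemma mpoly_ring_closed:
  "0 \<in> mpoly_ring n" "pconst c \<in> mpoly_ring n"
  "f \<in> mpoly_ring n \<Longrightarrow> g \<in> mpoly_ring n \<Longrightarrow> f + g \<in> mpoly_ring n"
  "f \<in> mpoly_ring n \<Longrightarrow> g \<in> mpoly_ring n \<Longrightarrow> f * g \<in> mpoly_ring n"
  "f \<in> mpoly_ring n \<Longrightarrow> - f \<in> mpoly_ring n"
proof -
  show "0 \<in> mpoly_ring n" "pconst c \<in> mpoly_ring n"
    by (auto simp: mpoly_ring_def pconst_def)
  show "f \<in> mpoly_ring n \<Longrightarrow> - f \<in> mpoly_ring n"
    by (auto simp: mpoly_ring_def)
  assume "f \<in> mpoly_ring n" "g \<in> mpoly_ring n"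
  then have f: "\<And>m. m \<in> Poly_Mapping.keys f \<Longrightarrow> Poly_Mapping.keys m \<subseteq> {..<n}"
    and g: "\<And>m. m \<in> Poly_Mapping.keys g \<Longrightarrow> Poly_Mapping.keys m \<subseteq> {..<n}"
    by (auto simp: mpoly_ring_def)
  show "f + g \<in> mpoly_ring n"
    using f g keys_add[of f g] unfolding mpoly_ring_def by blast
  show "f * g \<in> mpoly_ring n"
    unfolding mpoly_ring_def
  proof (rule CollectI, rule ballI)
    fix m assume "m \<in> Poly_Mapping.keys (f * g)"
    then obtain a b where "m = a + b" "a \<in> Poly_Mapping.keys f" "b \<in> Poly_Mapping.keys g"
      using keys_mult[of f g] by blast
    then show "Poly_Mapping.keys m \<subseteq> {..<n}"
      using f g keys_add[of a b] by blast
  qed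
qed

lemma mpoly_ring_sum: "(\<And>i. i \<in> I \<Longrightarrow> f i \<in> mpoly_ring n) \<Longrightarrow> sum f I \<in> mpoly_ring n"
  by (induction I rule: infinite_finite_induct) (auto simp: mpoly_ring_closed)

lemma mpoly_ring_prod: "(\<And>i. i \<in> I \<Longrightarrow> f i \<in> mpoly_ring n) \<Longrightarrow> prod f I \<in> mpoly_ring n"
  using mpoly_ring_closed(2)[of 1 n]
  by (induction I rule: infinite_finite_induct) (auto simp: mpoly_ring_closed(4) pconst_1)

lemma pderiv_wrt_closed: "f \<in> mpoly_ring n \<Longrightarrow> pderiv_wrt j f \<in> mpoly_ring n"
  unfolding pderiv_wrt_def
proof (rule mpoly_ring_sum)
  fix m assume m: "f \<in> mpoly_ring n" "m \<in> Poly_Mapping.keys f"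
  have "Poly_Mapping.keys (m - Poly_Mapping.single j 1) \<subseteq> Poly_Mapping.keys m"
    by (auto simp: in_keys_iff lookup_minus)
  then show "Poly_Mapping.single (m - Poly_Mapping.single j 1)
      (of_nat (Poly_Mapping.lookup m j) * Poly_Mapping.lookup f m) \<in> mpoly_ring n"
    using m by (force simp: mpoly_ring_def)
qed

section \<open>The Jacobian derivation\<close>

text \<open>Only the last row of the Jacobian matrix depends on \<open>g\<close>; Laplace expansion
  along it gives its cofactors as the coefficients \<open>c j\<close>.\<close>

lemma jacobian_der_expand:
  fixes F :: "'a::comm_ring_1 mpoly list"
  assumes n: "n \<ge> 1" and F: "length F = n - 1"
  shows "\<exists>c. \<forall>g. jacobian_der n F g = (\<Sum>j<n. pderiv_wrt j g * c j)"
proof (intro exI allI)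
  define M where "M g = mat n n (\<lambda>(i, j). pderiv_wrt j ((F @ [g]) ! i))" for g
  fix g
  have "cofactor (M g) (n - 1) j = cofactor (M 0) (n - 1) j" if "j < n" for j
  proof -
    have "mat_delete (M g) (n - 1) j = mat_delete (M 0) (n - 1) j"
      using n F that by (intro eq_matI) (auto simp: mat_delete_def M_def nth_append)
    then show ?thesis by (simp add: cofactor_def)
  qed
  then have "det (M g) = (\<Sum>j<n. M g $$ (n - 1, j) * cofactor (M 0) (n - 1) j)"
    using n laplace_expansion_row[of "M g" n "n - 1"] by (simp add: M_def)
  also have "\<dots> = (\<Sum>j<n. pderiv_wrt j g * cofactor (M 0) (n - 1) j)"
    using n F by (intro sum.cong) (auto simp: M_def nth_append)
  finally show "jacobian_der n F g = (\<Sum>j<n. pderiv_wrt j g * cofactor (M 0) (n - 1) j)"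
    by (simp add: jacobian_der_def M_def)
qed

lemma jacobian_der_derivation:
  fixes F :: "'a::comm_ring_1 mpoly list"
  assumes n: "n \<ge> 1" and F: "length F = n - 1"
  shows "jacobian_der n F (f + g) = jacobian_der n F f + jacobian_der n F g"
    "jacobian_der n F (f * g) = jacobian_der n F f * g + f * jacobian_der n F g"
    "jacobian_der n F (pconst a) = 0"
proof -
  obtain c where c: "\<And>g. jacobian_der n F g = (\<Sum>j<n. pderiv_wrt j g * c j)"
    using jacobian_der_expand[OF n F] by blast
  show "jacobian_der n F (f + g) = jacobian_der n F f + jacobian_der n F g"
    by (simp add: c pderiv_wrt_add distrib_right sum.distrib)
  show "jacobian_der n F (f * g) = jacobian_der n F f * g + f * jacobian_der n F g"
    by (simp add: c pderiv_wrt_mult sum_distrib_left sum_distrib_right sum.distrib[symmetric] algebra_simps)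
  show "jacobian_der n F (pconst a) = 0"
    by (simp add: c pderiv_wrt_pconst)
qed

text \<open>The last row of the matrix repeats the row of \<open>f\<close>.\<close>

lemma jacobian_der_self:
  fixes F :: "'a::comm_ring_1 mpoly list"
  assumes n: "n \<ge> 1" and F: "length F = n - 1" and f: "f \<in> set F"
  shows "jacobian_der n F f = 0"
proof -
  obtain i where i: "i < n - 1" "F ! i = f" using f F by (auto simp: in_set_conv_nth)
  show ?thesis unfolding jacobian_der_def
    by (rule det_identical_rows[where n = n and i = i and j = "n - 1"])
      (use i n F in \<open>auto simp: nth_append intro!: eq_vecI\<close>)
qed

lemma jacobian_der_closed:
  assumes F: "length F = n - 1" "set F \<subseteq> mpoly_ring n" and g: "g \<in> mpoly_ring n"
  shows "jacobian_der n F g \<in> mpoly_ring n"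
proof -
  have sgn: "signof q \<in> mpoly_ring n" for q :: "nat \<Rightarrow> nat"
    using mpoly_ring_closed(2)[of 1 n] mpoly_ring_closed(5)[of 1 n]
    by (auto simp: sign_def pconst_1)
  have "(F @ [g]) ! i \<in> mpoly_ring n" if "i < n" for i
    using F g that by (auto simp: nth_append subset_iff in_set_conv_nth)
  then show ?thesis
    unfolding jacobian_der_def
    by (subst det_def'[of _ n])
      (auto intro!: mpoly_ring_sum mpoly_ring_closed(4) sgn mpoly_ring_prod pderiv_wrt_closed
        dest: permutes_in_image)
qed

text \<open>The general Leibniz rule, free of division and hence valid in every characteristic; the
  induction step is Pascal's rule.\<close>

lemma derivation_power_mult:
  fixes d :: "'b::comm_ring_1 \<Rightarrow> 'b"
  assumes add: "\<And>f g. d (f + g) = d f + d g" and mult: "\<And>f g. d (f * g) = d f * g + f * d g"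
  shows "(d ^^ l) (f * g) = (\<Sum>i\<le>l. of_nat (l choose i) * ((d ^^ i) f * (d ^^ (l - i)) g))"
proof (induction l)
  case (Suc l)
  have d0: "d 0 = 0" using add[of 0 0] by simp
  have dsum: "d (sum h I) = (\<Sum>i\<in>I. d (h i))" for h :: "nat \<Rightarrow> 'b" and I
    by (induction I rule: infinite_finite_induct) (auto simp: d0 add)
  have dnat: "d (of_nat k * a) = of_nat k * d a" for k a
    by (induction k) (auto simp: d0 add distrib_right)
  let ?t = "\<lambda>i k. (d ^^ i) f * (d ^^ k) g"
  have dt: "d (?t i k) = ?t (Suc i) k + ?t i (Suc k)" for i k
    by (simp add: mult)
  have "(d ^^ Suc l) (f * g) = (\<Sum>i\<le>l. of_nat (l choose i) * ?t (Suc i) (l - i)) +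
      (\<Sum>i\<le>l. of_nat (l choose i) * ?t i (Suc (l - i)))"
  proof -
    have "(d ^^ Suc l) (f * g) = d (\<Sum>i\<le>l. of_nat (l choose i) * ?t i (l - i))"
      by (simp add: Suc)
    then show ?thesis by (simp only: dsum dnat dt distrib_left sum.distrib)
  qed
  \<comment> \<open>The added term \<open>i = Suc l\<close> has binomial coefficient 0; splitting
    off \<open>i = 0\<close> next aligns the two sums for Pascal's rule.\<close>
  also have "(\<Sum>i\<le>l. of_nat (l choose i) * ?t i (Suc (l - i))) =
      (\<Sum>i\<le>Suc l. of_nat (l choose i) * ?t i (Suc l - i))"
    by (simp add: Suc_diff_le binomial_eq_0)
  also have "\<dots> = ?t 0 (Suc l) + (\<Sum>i\<le>l. of_nat (l choose Suc i) * ?t (Suc i) (l - i))"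
    by (subst sum.atMost_Suc_shift) simp
  also have "(\<Sum>i\<le>l. of_nat (l choose i) * ?t (Suc i) (l - i)) + \<dots> =
      ?t 0 (Suc l) + (\<Sum>i\<le>l. of_nat (Suc l choose Suc i) * ?t (Suc i) (l - i))"
    by (simp add: distrib_right sum.distrib algebra_simps)
  also have "\<dots> = (\<Sum>i\<le>Suc l. of_nat (Suc l choose i) * ?t i (Suc l - i))"
    by (subst sum.atMost_Suc_shift) simp
  finally show ?case .
qed simp

section \<open>Calculations as if in characteristic zero\<close>

lemma char0_eval_add: "char0_eval (q + r) = char0_eval q + char0_eval r"
  unfolding char0_eval_def
  by (rule setsum_keys_plus_distrib[where f = "\<lambda>m a. of_int a * (\<Prod>c\<in>Poly_Mapping.keys m. c ^ Poly_Mapping.lookup m c)"])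
    (simp_all add: distrib_right)

lemma char0_eval_single:
  "char0_eval (Poly_Mapping.single m a) =
    of_int a * (\<Prod>c\<in>Poly_Mapping.keys m. c ^ Poly_Mapping.lookup m c)"
  by (cases "a = 0") (simp_all add: char0_eval_def)

lemma char0_eval_0: "char0_eval 0 = 0"
  by (simp add: char0_eval_def)

text \<open>Evaluation is the ring homomorphism sending T_c to c; on monomials this is the law of
  exponents.\<close>

lemma char0_eval_mult: "char0_eval (q * r) = char0_eval q * char0_eval r"
proof (rule poly_mapping_mult_hom[OF char0_eval_add])
  fix m k :: "'a \<Rightarrow>\<^sub>0 nat" and a b :: int
  \<comment> \<open>The monomials may have different supports; all products are extended to the
    union, where missing variables contribute c^0 = 1.\<close>
  have ext: "(\<Prod>c\<in>Poly_Mapping.keys m'. c ^ Poly_Mapping.lookup m' c) =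
      (\<Prod>c\<in>Poly_Mapping.keys m \<union> Poly_Mapping.keys k. c ^ Poly_Mapping.lookup m' c)"
    if "Poly_Mapping.keys m' \<subseteq> Poly_Mapping.keys m \<union> Poly_Mapping.keys k" for m' :: "'a \<Rightarrow>\<^sub>0 nat"
    using that by (intro prod.mono_neutral_left) (auto simp: in_keys_iff)
  show "char0_eval (Poly_Mapping.single m a * Poly_Mapping.single k b) =
      char0_eval (Poly_Mapping.single m a) * char0_eval (Poly_Mapping.single k b)"
    using ext[of m] ext[of k] ext[of "m + k"] keys_add[of m k]
    by (simp add: mult_single char0_eval_single lookup_add power_add prod.distrib ac_simps)
qed

lemma char0_eval_of_nat: "char0_eval (of_nat k) = of_nat k"
proof -
  have "of_nat k = (Poly_Mapping.single 0 (of_nat k) :: 'a char0)" by simp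
  then show ?thesis by (simp only: char0_eval_single) simp
qed

lemma lookup_char0_reduce: "Poly_Mapping.lookup (char0_reduce q) m = char0_eval (Poly_Mapping.lookup q m)"
  by (simp add: char0_reduce_def Poly_Mapping.map.rep_eq when_def char0_eval_0)

lemma char0_reduce_single:
  "char0_reduce (Poly_Mapping.single m a) = Poly_Mapping.single m (char0_eval a)"
  by (intro poly_mapping_eqI) (simp add: lookup_char0_reduce lookup_single when_def char0_eval_0)

lemma char0_reduce_add: "char0_reduce (q + r) = char0_reduce q + char0_reduce r"
  by (intro poly_mapping_eqI) (simp add: lookup_char0_reduce lookup_add char0_eval_add)

lemma char0_reduce_mult: "char0_reduce (q * r) = char0_reduce q * char0_reduce r"
  by (rule poly_mapping_mult_hom[OF char0_reduce_add])
    (simp add: mult_single char0_reduce_single char0_eval_mult)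

lemma char0_reduce_0: "char0_reduce 0 = 0"
  by (intro poly_mapping_eqI) (simp add: lookup_char0_reduce char0_eval_0)

lemma char0_reduce_1: "char0_reduce 1 = (1 :: 'a::comm_ring_1 mpoly)"
  using char0_reduce_single[of 0 "1 :: 'a char0"] char0_eval_of_nat[of 1, where ?'a = 'a] by simp

text \<open>Differentiation multiplies coefficients by exponents, and \<open>char0_eval\<close>
  preserves natural numbers.\<close>

lemma char0_reduce_pderiv_wrt: "char0_reduce (pderiv_wrt j q) = pderiv_wrt j (char0_reduce q)"
  by (induction q rule: poly_mapping_single_induct)
    (simp_all add: pderiv_wrt_single char0_reduce_single char0_eval_mult char0_eval_of_nat
      pderiv_wrt_add char0_reduce_add)

text \<open>Evaluation sends T_c back to c. Zero coefficients stay 0 instead of becoming T_0, and 0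
  evaluates to 0 as well.\<close>

lemma char0_reduce_lift: "char0_reduce (char0_lift f) = f"
proof (intro poly_mapping_eqI)
  fix m
  have "Poly_Mapping.lookup (char0_lift f) m =
      (if Poly_Mapping.lookup f m = 0 then 0
       else Poly_Mapping.single (Poly_Mapping.single (Poly_Mapping.lookup f m) 1) 1)"
    by (simp add: char0_lift_def Poly_Mapping.map.rep_eq when_def)
  then show "Poly_Mapping.lookup (char0_reduce (char0_lift f)) m = Poly_Mapping.lookup f m"
    by (simp add: lookup_char0_reduce char0_eval_0 char0_eval_single)
qed

text \<open>Ring homomorphisms commute with determinants, and this one also with the partial
  derivatives in the entries.\<close>

lemma char0_reduce_jacobian_der:
  assumes "length F = n - 1"
  shows "char0_reduce (jacobian_der n F g) = jacobian_der n (map char0_reduce F) (char0_reduce g)"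
proof -
  interpret comm_ring_hom char0_reduce
    by unfold_locales (simp_all add: char0_reduce_add char0_reduce_mult char0_reduce_0 char0_reduce_1)
  show ?thesis
    unfolding jacobian_der_def hom_det[symmetric] using assms
    by (intro arg_cong[where f = det] eq_matI) (auto simp: nth_append char0_reduce_pderiv_wrt)
qed

text \<open>\<open>char0_lift\<close> is not additive, so the calculation is followed through the
  homomorphism \<open>char0_reduce\<close>, which turns each lifted step into one application of
  \<open>jacobian_der n F\<close>.\<close>

lemma bracket_jacobian_pow_eq:
  assumes F: "length F = n - 1"
  shows "bracket_jacobian_pow n F l g = (jacobian_der n F ^^ l) g"
proof -
  have lift: "map char0_reduce (map char0_lift F) = F"
    by (simp add: char0_reduce_lift o_def map_idI)
  have "char0_reduce ((jacobian_der n (map char0_lift F) ^^ l) q) = (jacobian_der n F ^^ l) (char0_reduce q)" for q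
    by (induction l) (use F in \<open>simp_all add: char0_reduce_jacobian_der lift[unfolded map_map]\<close>)
  then show ?thesis by (simp add: bracket_jacobian_pow_def char0_reduce_lift)
qed

section \<open>Inverses of factorials\<close>

lemma cring_ring_on_UNIV: "cring (ring_on (UNIV :: 'a::comm_ring_1 set))"
proof -
  have "\<exists>y. y + x = 0" for x :: 'a by (intro exI[of _ "- x"]) simp
  then show ?thesis
    by (intro cringI abelian_groupI comm_monoidI) (auto simp: algebra_simps)
qed

lemma a_inv_ring_on_UNIV: "\<ominus>\<^bsub>ring_on UNIV\<^esub> x = - (x :: 'a::comm_ring_1)"
proof -
  interpret cring "ring_on (UNIV :: 'a set)" by (rule cring_ring_on_UNIV)
  show ?thesis by (rule minus_equality) simp_all
qed

text \<open>A positive characteristic p of a domain is prime and does not divide l! for l < p; in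
  characteristic 0 no factorial vanishes. So l! is a nonzero element of the subfield and has its
  inverse there.\<close>

lemma fact_inverse_of_prime_field:
  assumes K: "contains_prime_field TYPE('a::idom) p" and l: "p = 0 \<or> l \<le> p - 1"
  shows "of_nat (fact l) * (inv\<^bsub>ring_on (UNIV :: 'a set)\<^esub> of_nat (fact l)) = (1 :: 'a)"
proof -
  let ?R = "ring_on (UNIV :: 'a set)"
  interpret cring ?R by (rule cring_ring_on_UNIV)
  have p: "CHAR('a) = p" using K by (simp add: contains_prime_field_def)
  obtain K :: "'a set" where K: "subfield K ?R"
    using K by (auto simp: contains_prime_field_def)
  note sub = subringE[OF subfieldE(1)[OF K]]
  have inK: "of_nat k \<in> K" for k
    using sub(2,3,7) by (induction k) auto
  have "\<not> p dvd fact l"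
  proof (cases "p = 0")
    case False
    then have "Factorial_Ring.prime p" using prime_CHAR_semidom[where ?'a = 'a] p by simp
    moreover have "\<not> p \<le> l" using l False by auto
    ultimately show ?thesis by (simp add: prime_dvd_fact_iff)
  qed (simp del: of_nat_fact)
  then have "(of_nat (fact l) :: 'a) \<noteq> 0"
    by (simp only: of_nat_eq_0_iff_char_dvd p) simp
  then show ?thesis
    using subfield_m_inv(2)[OF K, of "of_nat (fact l)"] inK[of "fact l"] by simp
qed

section \<open>Divided powers of a derivation\<close>

lemma of_nat_choose_inverse_facts:
  fixes c :: "nat \<Rightarrow> 'a::comm_ring_1"
  assumes c: "\<And>j. j \<le> l \<Longrightarrow> of_nat (fact j) * c j = 1" and i: "i \<le> l"
  shows "c l * of_nat (l choose i) = c i * c (l - i)"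
proof -
  have "of_nat (fact i) * of_nat (fact (l - i)) * of_nat (l choose i) = (of_nat (fact l) :: 'a)"
    using binomial_fact_lemma[OF i] by (metis of_nat_mult)
  \<comment> \<open>One product is evaluated twice: here l! cancels against \<open>c l\<close>,
    below i! and (l-i)! cancel against their own inverses.\<close>
  then have "c l * (of_nat (fact i) * of_nat (fact (l - i)) * of_nat (l choose i)) * (c i * c (l - i)) =
      c i * c (l - i)"
    using c[of l] by (simp add: mult.commute del: of_nat_fact)
  moreover have "c l * (of_nat (fact i) * of_nat (fact (l - i)) * of_nat (l choose i)) * (c i * c (l - i)) =
      c l * of_nat (l choose i) * ((of_nat (fact i) * c i) * (of_nat (fact (l - i)) * c (l - i)))"
    by (simp only: ac_simps)
  ultimately show ?thesis using c[of i] c[of "l - i"] i by (simp del: of_nat_fact)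
qed

text \<open>Scaling the general Leibniz rule by 1/l! absorbs the binomial coefficients, which leaves
  the product rule of a higher derivation.\<close>

lemma derivation_divided_power_mult:
  fixes d :: "'a::comm_ring_1 mpoly \<Rightarrow> 'a mpoly" and c :: "nat \<Rightarrow> 'a"
  assumes add: "\<And>f g. d (f + g) = d f + d g" and mult: "\<And>f g. d (f * g) = d f * g + f * d g"
    and c: "\<And>j. j \<le> l \<Longrightarrow> of_nat (fact j) * c j = 1"
  shows "pconst (c l) * (d ^^ l) (f * g) =
    (\<Sum>i\<le>l. (pconst (c i) * (d ^^ i) f) * (pconst (c (l - i)) * (d ^^ (l - i)) g))"
proof -
  have "pconst (c l) * (of_nat (l choose i) * ((d ^^ i) f * (d ^^ (l - i)) g)) =
      (pconst (c i) * (d ^^ i) f) * (pconst (c (l - i)) * (d ^^ (l - i)) g)" if "i \<le> l" for i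
  proof -
    have "pconst (c l) * of_nat (l choose i) = pconst (c i) * pconst (c (l - i))"
      using of_nat_choose_inverse_facts[OF c that]
      by (simp only: pconst_of_nat[symmetric] pconst_mult[symmetric])
    then show ?thesis by (metis (no_types, lifting) mult.assoc mult.left_commute)
  qed
  then show ?thesis
    unfolding derivation_power_mult[of d, OF add mult] sum_distrib_left
    by (intro sum.cong) simp_all
qed

text \<open>The kernel of a derivation that kills the constants is a subalgebra, so the generators
  decide.\<close>

lemma derivation_kills_gen_alg:
  fixes d :: "'a::comm_ring_1 mpoly \<Rightarrow> 'a mpoly"
  assumes add: "\<And>f g. d (f + g) = d f + d g" and mult: "\<And>f g. d (f * g) = d f * g + f * d g"
    and const: "\<And>a. d (pconst a) = 0" and S: "\<And>f. f \<in> S \<Longrightarrow> d f = 0" and f: "f \<in> gen_alg S"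
  shows "d f = 0"
  using f unfolding gen_alg_def
proof (induction rule: generate_ring.induct)
  case one
  then show ?case using const[of 1] by (simp add: pconst_1)
next
  case (incl h)
  then show ?case using const S by auto
next
  case (a_inv h)
  have "d 0 = 0" using add[of 0 0] by simp
  then have "d h + d (- h) = 0" using add[of h "- h"] by simp
  then show ?case using a_inv by (simp add: a_inv_ring_on_UNIV)
qed (simp_all add: add mult)

section \<open>Construction of the higher derivation of Jacobian type\<close>

theorem proposition2p5:
  fixes p n :: nat and F :: "'a::idom mpoly list"
  assumes "contains_prime_field TYPE('a) p"
    and "n \<ge> 1"
    and "length F = n - 1"
    and "set F \<subseteq> mpoly_ring n - gen_alg {pvar j ^ p | j. j < n}"
    and "alg_iso (gen_alg (set F)) (mpoly_ring (n - 1))"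
    and "smooth (ring_on (gen_alg (set F))) (ring_on (mpoly_ring n)) (\<lambda>b. b)"
  shows "\<exists>D. higher_derivation n D \<and> jacobian_type p n F D"
proof -
  let ?A = "gen_alg (set F)" and ?B = "mpoly_ring n :: 'a mpoly set"
  define \<delta> where "\<delta> = jacobian_der n F"
  define c :: "nat \<Rightarrow> 'a" where "c l = inv\<^bsub>ring_on (UNIV :: 'a set)\<^esub> of_nat (fact l)" for l
  \<comment> \<open>The divided powers of \<delta>; they are used only for \<open>p = 0\<close> or
    \<open>l < p\<close>, where \<open>c l\<close> is an inverse of l!.\<close>
  define E where "E l g = pconst (c l) * (\<delta> ^^ l) g" for l g
  note der = jacobian_der_derivation[OF assms(2,3), folded \<delta>_def]
  have c: "of_nat (fact l) * c l = 1" if "p = 0 \<or> l \<le> p - 1" for l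
    unfolding c_def by (rule fact_inverse_of_prime_field[OF assms(1) that])
  have FB: "set F \<subseteq> ?B" using assms(4) by auto
  have \<delta>A: "\<delta> a = 0" if "a \<in> ?A" for a
    by (rule derivation_kills_gen_alg[OF der _ that])
      (simp add: \<delta>_def jacobian_der_self[OF assms(2,3)])
  have \<delta>B: "(\<delta> ^^ l) g \<in> ?B" if "g \<in> ?B" for l g
    using that by (induction l) (auto simp: \<delta>_def jacobian_der_closed[OF assms(3) FB])
  have \<delta>0: "(\<delta> ^^ l) 0 = 0" for l
    using der(3)[of 0] by (induction l) (simp_all add: pconst_def)
  have \<delta>add: "(\<delta> ^^ l) (f + g) = (\<delta> ^^ l) f + (\<delta> ^^ l) g" for l f g
    by (induction l) (simp_all add: der)
  \<comment> \<open>The second condition prescribes the divided power where l! is invertible; beyond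
    that range any extension is accepted.\<close>
  define P where "P D l r \<longleftrightarrow> hd_component ?A ?B D l r \<and>
      (p = 0 \<or> l \<le> p - 1 \<longrightarrow> (\<forall>g\<in>?B. r g = E l g))" for D l r
  have "\<exists>D. \<forall>l. P D l (D l)"
  \<comment> \<open>A lift need not be unique and depends on the components before it, so they are
    chosen recursively.\<close>
  proof (rule dependent_wellorder_choice)
    fix r and D D' :: "nat \<Rightarrow> 'a mpoly \<Rightarrow> 'a mpoly" and l
    assume "\<And>y. y < l \<Longrightarrow> D y = D' y"
    then show "P D l r = P D' l r" unfolding P_def by (simp cong: hd_component_cong)
  next
    fix l and D :: "nat \<Rightarrow> 'a mpoly \<Rightarrow> 'a mpoly"
    assume IH: "\<And>i. i < l \<Longrightarrow> P D i (D i)"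
    show "\<exists>r. P D l r"
    proof (cases "p = 0 \<or> l \<le> p - 1")
      case True
      then have small: "p = 0 \<or> i \<le> p - 1" if "i \<le> l" for i using that by auto
      \<comment> \<open>The earlier components are known to agree with \<open>E\<close> on
        \<open>?B\<close> only, which is where the product rule is needed.\<close>
      have DE: "(D(l := E l)) i f = E i f" if "i \<le> l" "f \<in> ?B" for i f
        using IH[of i] small[of i] that by (cases "i = l") (auto simp: P_def)
      have "hd_component ?A ?B D l (E l)"
        unfolding hd_component_def
      proof (intro conjI ballI impI)
        fix f assume f: "f \<in> ?B"
        show "E l f \<in> ?B" unfolding E_def by (intro mpoly_ring_closed \<delta>B f)
        show "E l f = f" if "l = 0" using c[of 0] that by (simp add: E_def pconst_1)
        fix g assume g: "g \<in> ?B"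
        show "E l (f + g) = E l f + E l g" by (simp add: E_def \<delta>add distrib_left)
        have "E l (f * g) = (\<Sum>i\<le>l. E i f * E (l - i) g)"
          unfolding E_def using der(1,2) c small by (intro derivation_divided_power_mult) auto
        also have "\<dots> = (\<Sum>i\<le>l. (D(l := E l)) i f * (D(l := E l)) (l - i) g)"
          using f g by (intro sum.cong refl arg_cong2[where f = "(*)"] DE[symmetric]) auto
        finally show "E l (f * g) = \<dots>" .
      next
        fix a assume "l \<ge> 1" "a \<in> ?A"
        \<comment> \<open>The innermost application is peeled off, since already
          \<open>\<delta> a = 0\<close>.\<close>
        then show "E l a = 0"
          by (cases l) (simp_all add: E_def funpow_Suc_right \<delta>A \<delta>0 del: funpow.simps(2))
      qed
      then show ?thesis by (auto simp: P_def)
    next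
      case False
      \<comment> \<open>Here \<open>p > 0\<close> and \<open>l \<ge> p\<close>, so
        \<open>l \<ge> 1\<close> as the extension requires.\<close>
      then have "\<exists>r. hd_component ?A ?B D l r"
        using IH by (intro smooth_extend_higher_derivation[OF assms(6)]) (auto simp: P_def)
      then show ?thesis using False by (auto simp: P_def)
    qed
  qed
  then obtain D where D: "\<And>l. hd_component ?A ?B D l (D l)"
    and DE: "\<And>l g. p = 0 \<or> l \<le> p - 1 \<Longrightarrow> g \<in> ?B \<Longrightarrow> D l g = E l g"
    unfolding P_def by blast
  have DB: "D l f \<in> ?B" and Dadd: "D l (f + g) = D l f + D l g" and D0: "D 0 f = f"
    and Dmult: "D l (f * g) = (\<Sum>i\<le>l. D i f * D (l - i) g)" if "f \<in> ?B" "g \<in> ?B" for l f g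
    using D[of l] D[of 0] that by (simp_all add: hd_component_def)
  have DA: "D l a = 0" if "l \<ge> 1" "a \<in> ?A" for l a
    using D[of l] that by (simp add: hd_component_def)
  have constA: "pconst a \<in> ?A" for a :: 'a
    unfolding gen_alg_def by (intro generate_ring.incl) simp
  have FA: "set F \<subseteq> ?A"
    unfolding gen_alg_def by (auto intro: generate_ring.incl)
  \<comment> \<open>Constants lie in R[F], so every term of the product rule with
    \<open>i \<ge> 1\<close> vanishes.\<close>
  have Dlin: "D l (pconst a * f) = pconst a * D l f" if "f \<in> ?B" for l a f
  proof -
    have "D l (pconst a * f) = D 0 (pconst a) * D (l - 0) f + (\<Sum>i\<in>{..l} - {0}. D i (pconst a) * D (l - i) f)"
      using that by (simp add: Dmult mpoly_ring_closed sum.remove[of "{..l}" 0])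
    then show ?thesis using that constA by (simp add: DA D0 mpoly_ring_closed)
  qed
  have "higher_derivation n D"
    unfolding higher_derivation_def using DB Dadd D0 Dmult Dlin by blast
  moreover have "jacobian_type p n F D"
    unfolding jacobian_type_def
  proof (intro conjI allI ballI impI)
    show "alg_iso ?A (mpoly_ring (n - 1))" by fact
    show "set F \<subseteq> hd_kernel n D" using FB FA DA by (auto simp: hd_kernel_def)
  next
    fix g assume g: "g \<in> ?B"
    \<comment> \<open>Order 1 lies in the prescribed range because a nonzero ring never has
      characteristic 1.\<close>
    have "p \<noteq> 1" using assms(1) CHAR_not_1[where ?'a = 'a] by (auto simp: contains_prime_field_def)
    then have "p = 0 \<or> 1 \<le> p - 1" by auto
    then have "c 1 = 1" "D 1 g = E 1 g" using c[of 1] DE g by auto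
    then show "D 1 g = tilde_jacobian_der n F g"
      by (simp add: E_def pconst_1 tilde_jacobian_der_def bracket_jacobian_pow_eq[OF assms(3)] \<delta>_def)
  next
    fix l g assume "p = 0 \<or> l \<le> p - 1" "g \<in> ?B"
    then show "D l g = pconst (inv\<^bsub>ring_on (UNIV :: 'a set)\<^esub> of_nat (fact l)) * bracket_jacobian_pow n F l g"
      by (simp only: DE E_def c_def bracket_jacobian_pow_eq[OF assms(3)] \<delta>_def)
  qed
  ultimately show ?thesis by blast
qed

end
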